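(* Let $m \ge n\ge 4$ and $k\ge 1$ be integers, and let $K_{n,m}$ be the complete bipartite graph with parts of sizes $n$ and $m$. Then \[\ddot{\gamma}_P^k(K_{n,m}) \ge \begin{cases} 2(k+1)- 4\left\lfloor \frac{k}{n+2} \right\rfloor & \text{if } k \equiv i \pmod{n+2} \text{ for some } 0\le i\le n-4,\\[4pt] k+n-1 +(n-2)\left\lfloor \frac{k}{n+2}\right\rfloor & \text{otherwise.} \end{cases}\]
   Context: Graphs are finite and simple. For a vertex $v$, $N[v]$ denotes its closed neighborhood. The power domination process on a graph $G$ with initial set $S\subseteq V(G)$: (1) set $B=\bigcup_{v\in S}N[v]$; (2) while there is $v\in B$ with exactly one neighbor $u\notin B$, add $u$ to $B$. A set $S$ is a power dominating set of $G$ if $B=V(G)$ when the process terminates. A multiset of vertices is called a power dominating set if its underlying set is one. For an integer $k\ge 0$, a $k$-robust power dominating set of $G$ is a finite multiset $S$ of elements of $V(G)$ with $|S|\ge k$ (counted with multiplicity) such that for every submultiset $F$ of $S$ with $|F|=k$, the multiset difference $S\setminus F$ is a power dominating set of $G$. $\ddot{\gamma}_P^k(G)$ denotes the minimum cardinality (with multiplicity) of a $k$-robust power dominating set of $G$. *)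

theory Defs
  imports
    "Graph_Theory.Kuratowski"
    "HOL-Library.Multiset"
    "HOL-Number_Theory.Cong"
begin

text \<open>
  A finite simple graph is a digraph satisfying the locale \<open>graph\<close> (finite, loop-free,
  without parallel arcs, symmetric); adjacency is membership in \<open>arcs_ends\<close>.
\<close>

definition closed_nbhd :: "('a, 'b) pre_digraph \<Rightarrow> 'a \<Rightarrow> 'a set" where
  "closed_nbhd G v = insert v {u. (v, u) \<in> arcs_ends G}"

inductive force_step :: "('a, 'b) pre_digraph \<Rightarrow> 'a set \<Rightarrow> 'a set \<Rightarrow> bool"
  for G :: "('a, 'b) pre_digraph" where
  "v \<in> B \<Longrightarrow> {w. (v, w) \<in> arcs_ends G \<and> w \<notin> B} = {u} \<Longrightarrow> force_step G B (insert u B)"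

text \<open>
  The process is nondeterministic in the choice of the forcing vertex. A run has terminated
  once no step applies, which is the case at the full vertex set. The lemma
  \<open>force_run_unique\<close> below shows that the final set does not depend on the choices, so it is
  harmless to ask for some run ending in the full vertex set.
\<close>

definition power_dominating :: "('a, 'b) pre_digraph \<Rightarrow> 'a set \<Rightarrow> bool" where
  "power_dominating G S \<longleftrightarrow>
     S \<subseteq> verts G \<and> (force_step G)\<^sup>*\<^sup>* (\<Union>v\<in>S. closed_nbhd G v) (verts G)"

definition robust_power_dominating ::
    "('a, 'b) pre_digraph \<Rightarrow> nat \<Rightarrow> 'a multiset \<Rightarrow> bool" where
  "robust_power_dominating G k S \<longleftrightarrow>
     set_mset S \<subseteq> verts G \<and> k \<le> size S \<and>
     (\<forall>F. F \<subseteq># S \<and> size F = k \<longrightarrow> power_dominating G (set_mset (S - F)))"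

text \<open>
  In a finite nonempty graph the minimum is attained, since \<open>k + 1\<close> copies of every vertex form
  a \<open>k\<close>-robust power dominating set.
\<close>

definition robust_power_domination_number :: "('a, 'b) pre_digraph \<Rightarrow> nat \<Rightarrow> nat" where
  "robust_power_domination_number G k =
     (LEAST s. \<exists>S. robust_power_dominating G k S \<and> size S = s)"

lemma force_run_subset:
  assumes "(force_step G)\<^sup>*\<^sup>* B C" "B \<subseteq> D" "\<nexists>D'. force_step G D D'"
  shows "C \<subseteq> D"
  using assms(1)
proof (induction rule: rtranclp_induct)
  case base
  show ?case by (rule assms(2))
next
  case (step C C')
  from step.hyps(2) obtain v u where v: "v \<in> C" "{w. (v, w) \<in> arcs_ends G \<and> w \<notin> C} = {u}"
    and C': "C' = insert u C" by (auto elim: force_step.cases)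
  have "u \<in> D"
  proof (rule ccontr)
    assume "u \<notin> D"
    then have "{w. (v, w) \<in> arcs_ends G \<and> w \<notin> D} = {u}" using v(2) step.IH by blast
    then have "force_step G D (insert u D)" using v(1) step.IH by (blast intro: force_step.intros)
    then show False using assms(3) by blast
  qed
  then show ?case using C' step.IH by simp
qed

lemma force_run_unique:
  assumes "(force_step G)\<^sup>*\<^sup>* B C" "\<nexists>C'. force_step G C C'"
    and "(force_step G)\<^sup>*\<^sup>* B D" "\<nexists>D'. force_step G D D'"
  shows "C = D"
proof -
  have mono: "B \<subseteq> X" if "(force_step G)\<^sup>*\<^sup>* B X" for X
    using that by (induction rule: rtranclp_induct) (auto elim!: force_step.cases)
  show ?thesis
    using force_run_subset[OF assms(1) mono[OF assms(3)] assms(4)]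
      force_run_subset[OF assms(3) mono[OF assms(1)] assms(2)] by blast
qed

end

theory Submission
  imports Defs
begin

text \<open>
  Two vertices \<open>i \<noteq> j\<close> on the same side \<open>V\<close> of a complete bipartite graph are twins: if neither they
  nor any of their neighbours is chosen, then no vertex ever sees exactly one of them outside the
  observed set. Hence a \<open>k\<close>-robust power dominating multiset with \<open>A\<close> elements on the other
  side \<open>U\<close> and multiplicities \<open>a\<close> on \<open>V\<close> satisfies \<open>a i + a j + A > k\<close>. Let \<open>A\<close> be at most the number
  of elements on \<open>V\<close> and put \<open>q = \<lfloor>k / (n + 2)\<rfloor>\<close>. If \<open>A > k - 2q\<close>, then doubling \<open>A\<close> gives a total of at
  least \<open>2(k + 1) - 4q\<close>. Otherwise every multiplicity on \<open>V\<close> except the smallest one exceeds \<open>q\<close>, and the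
  total is at least \<open>(k + 1) + (n - 2)(q + 1)\<close>. Which of the two bounds is the smaller one is
  decided by whether \<open>k mod (n + 2)\<close> is at most \<open>n - 3\<close>; they agree at \<open>n - 3\<close>.
\<close>

text \<open>Robustness only tests deletions of size exactly \<open>k\<close>, so a smaller multiset
  of elements to be deleted has to be padded first.\<close>

lemma multiset_interpolate:
  assumes "M \<subseteq># N" "size M \<le> k" "k \<le> size N"
  obtains F where "M \<subseteq># F" "F \<subseteq># N" "size F = k"
proof -
  have "\<exists>F. M \<subseteq># F \<and> F \<subseteq># N \<and> size F = k"
    using assms(2,3)
  proof (induction k rule: dec_induct)
    case base
    show ?case using assms(1) by blast
  next
    case (step l)
    then obtain F where F: "M \<subseteq># F" "F \<subseteq># N" "size F = l" by auto
    with step.prems have "size F < size N" by simp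
    then obtain x where "count F x < count N x"
      using size_lt_imp_ex_count_lt by blast
    then have "add_mset x F \<subseteq># N"
      using F(2) by (auto simp: subseteq_mset_def Suc_le_eq)
    moreover have "M \<subseteq># add_mset x F"
      using F(1) by (rule subset_mset.order_trans) simp
    ultimately show ?case using F(3) by (intro exI[of _ "add_mset x F"]) simp
  qed
  then show ?thesis using that by blast
qed

lemma power_dominating_meets_twins:
  assumes "power_dominating G S" "i \<in> verts G" "i \<noteq> j"
    and sym: "sym (arcs_ends G)"
    and twins: "\<And>v. v \<rightarrow>\<^bsub>G\<^esub> i \<longleftrightarrow> v \<rightarrow>\<^bsub>G\<^esub> j"
  shows "\<exists>v\<in>S. v = i \<or> v = j \<or> v \<rightarrow>\<^bsub>G\<^esub> i"
proof (rule ccontr)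
  assume none: "\<not> ?thesis"
  \<comment> \<open>The complement of the twins is stuck: a forcing vertex would see exactly one of
    them. By \<open>force_run_subset\<close>, a run that starts inside it never leaves it.\<close>
  have "\<nexists>D'. force_step G (- {i, j}) D'"
  proof
    assume "\<exists>D'. force_step G (- {i, j}) D'"
    then obtain D' where "force_step G (- {i, j}) D'" ..
    then show False
    proof cases
      case (1 v u)
      have "v \<rightarrow>\<^bsub>G\<^esub> i \<longleftrightarrow> u = i" "v \<rightarrow>\<^bsub>G\<^esub> j \<longleftrightarrow> u = j" using 1(3) by auto
      moreover have "u = i \<or> u = j" using 1(3) by auto
      ultimately show False using twins[of v] \<open>i \<noteq> j\<close> by metis
    qed
  qed
  moreover have "(\<Union>v\<in>S. closed_nbhd G v) \<subseteq> - {i, j}"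
    using none twins by (auto simp: closed_nbhd_def)
  ultimately have "verts G \<subseteq> - {i, j}"
    using assms(1) force_run_subset unfolding power_dominating_def by blast
  then show False using assms(2) by blast
qed

text \<open>Otherwise a deletion of size \<open>k\<close> could remove every chosen element that
  observes \<open>i\<close> or \<open>j\<close> at the start.\<close>

lemma robust_power_dominating_twins:
  assumes rob: "robust_power_dominating G k S" and ij: "i \<in> verts G" "i \<noteq> j"
    and sym: "sym (arcs_ends G)"
    and twins: "\<And>v. v \<rightarrow>\<^bsub>G\<^esub> i \<longleftrightarrow> v \<rightarrow>\<^bsub>G\<^esub> j"
  shows "k < size {#v \<in># S. v = i \<or> v = j \<or> v \<rightarrow>\<^bsub>G\<^esub> i#}"
proof (rule ccontr)
  let ?M = "{#v \<in># S. v = i \<or> v = j \<or> v \<rightarrow>\<^bsub>G\<^esub> i#}"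
  assume "\<not> k < size ?M"
  then obtain F where F: "?M \<subseteq># F" "F \<subseteq># S" "size F = k"
    using multiset_interpolate[of ?M S k] rob
    by (auto simp: robust_power_dominating_def)
  then have "power_dominating G (set_mset (S - F))"
    using rob by (auto simp: robust_power_dominating_def)
  then obtain v where v: "v \<in># S - F" "v = i \<or> v = j \<or> v \<rightarrow>\<^bsub>G\<^esub> i"
    using power_dominating_meets_twins[OF _ ij sym twins] by blast
  have "count S v = count ?M v" using v(2) by auto
  also have "\<dots> \<le> count F v" using F(1) by (rule mset_subset_eq_count)
  finally show False using v(1) by (simp add: in_diff_count)
qed

text \<open>Deleting \<open>k\<close> elements cannot exhaust \<open>k + 1\<close> copies of a
  vertex. This witness ensures that the \<open>LEAST\<close> in the definition is attained.\<close>

lemma ex_robust_power_dominating: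
  assumes "wf_digraph G" "finite (verts G)" "verts G \<noteq> {}"
  shows "\<exists>S. robust_power_dominating G k S"
proof -
  let ?S = "repeat_mset (k + 1) (mset_set (verts G))"
  have count_S: "count ?S v = (if v \<in> verts G then k + 1 else 0)" for v
    using assms(2) by (simp add: count_mset_set' del: repeat_mset_Suc)
  then have "set_mset ?S \<subseteq> verts G"
    by (metis count_eq_zero_iff subsetI)
  have pd: "power_dominating G (verts G)"
  proof -
    have "(\<Union>v\<in>verts G. closed_nbhd G v) = verts G"
      using wf_digraph.adj_in_verts[OF assms(1)] by (auto simp: closed_nbhd_def)
    then show ?thesis by (simp add: power_dominating_def)
  qed
  have "set_mset (?S - F) = verts G" if "F \<subseteq># ?S" "size F = k" for F
  proof -
    have "count F v < k + 1" for v using that(2) count_le_size[of F v] by linarith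
    then have "count F v < count ?S v \<longleftrightarrow> v \<in> verts G" for v
      unfolding count_S by simp
    then show ?thesis by (intro set_eqI) (simp only: in_diff_count)
  qed
  moreover have "k \<le> size ?S"
    using assms(2,3) by (cases "card (verts G)") auto
  ultimately have "robust_power_dominating G k ?S"
    using pd \<open>set_mset ?S \<subseteq> verts G\<close> unfolding robust_power_dominating_def by metis
  then show ?thesis by blast
qed

text \<open>Take \<open>u\<close> minimizing \<open>a\<close> and pair it with any \<open>v\<close>;
  together they contribute at least \<open>c\<close>. Every other \<open>w\<close> has
  \<open>2 * a w \<ge> a u + a w \<ge> c > 2 * q\<close>, so it contributes at least
  \<open>q + 1\<close>.\<close>

lemma sum_pairwise_bound:
  fixes a :: "'a \<Rightarrow> nat"
  assumes "finite V" "2 \<le> card V"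
    and pair: "\<And>i j. i \<in> V \<Longrightarrow> j \<in> V \<Longrightarrow> i \<noteq> j \<Longrightarrow> c \<le> a i + a j"
    and q: "2 * q < c"
  shows "c + (card V - 2) * (q + 1) \<le> sum a V"
proof -
  have "V \<noteq> {}" using assms(2) by auto
  then obtain u where u: "u \<in> V" "\<And>v. v \<in> V \<Longrightarrow> a u \<le> a v"
    using \<open>finite V\<close> by (metis arg_min_if_finite(1) arg_min_least)
  have "card (V - {u}) \<noteq> 0" using assms(1,2) u(1) by simp
  then obtain v where v: "v \<in> V" "v \<noteq> u" by (metis DiffE card.empty ex_in_conv singletonI)
  have "q + 1 \<le> a w" if "w \<in> V - {u, v}" for w
    using pair[of u w] u that q by force
  then have "of_nat (card (V - {u, v})) * (q + 1) \<le> sum a (V - {u, v})"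
    by (rule sum_bounded_below)
  moreover have "card (V - {u, v}) = card V - 2"
    using u(1) v \<open>finite V\<close> by (simp add: card_Diff_subset)
  moreover have "sum a V = sum a (V - {u, v}) + (a u + a v)"
    using sum.subset_diff[of "{u, v}" V a] u(1) v \<open>finite V\<close> by simp
  moreover have "c \<le> a u + a v" using pair u(1) v by metis
  ultimately show ?thesis by simp
qed

text \<open>The part holding fewer elements of \<open>S\<close> plays \<open>U\<close>. Either part
  may be the lighter one, hence only \<open>n \<le> card V\<close> is asked.\<close>

lemma robust_size_lower_bound:
  assumes rob: "robust_power_dominating G k S"
    and verts: "verts G = U \<union> V" "U \<inter> V = {}" "finite U" "finite V"
    and arcs: "arcs_ends G = U \<times> V \<union> V \<times> U"
    and n: "2 \<le> n" "n \<le> card V"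
    and le: "sum (count S) U \<le> sum (count S) V"
  shows "2 * (k + 1) \<le> size S + 4 * q \<or> k + 1 + (n - 2) * (q + 1) \<le> size S"
proof -
  have "size S = sum (count S) (U \<union> V)"
    unfolding size_multiset_overloaded_eq using rob verts
    by (intro sum.mono_neutral_left) (auto simp: robust_power_dominating_def not_in_iff)
  then have size: "size S = sum (count S) U + sum (count S) V"
    using verts by (simp add: sum.union_disjoint)
  have pair: "k + 1 - sum (count S) U \<le> count S i + count S j" if "i \<in> V" "j \<in> V" "i \<noteq> j" for i j
  proof -
    let ?M = "{#v \<in># S. v = i \<or> v = j \<or> v \<rightarrow>\<^bsub>G\<^esub> i#}"
    have "k < size ?M"
      using that verts arcs
      by (intro robust_power_dominating_twins[OF rob]) (auto simp: sym_def)
    also have "size ?M = sum (count ?M) (insert i (insert j U))"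
      unfolding size_multiset_overloaded_eq using that verts arcs
      by (intro sum.mono_neutral_left) (auto simp: not_in_iff)
    also have "\<dots> = sum (count S) (insert i (insert j U))"
      using that arcs by (intro sum.cong) auto
    also have "\<dots> = count S i + count S j + sum (count S) U"
      using that verts by (subst sum.insert; auto)+
    finally show ?thesis by simp
  qed
  show ?thesis
  proof (cases "2 * q + sum (count S) U \<le> k")
    case True
    \<comment> \<open>In this case the truncated subtraction is exact and exceeds
      \<open>2 * q\<close>; adding the elements on \<open>U\<close> restores
      \<open>k + 1\<close>.\<close>
    then have "k + 1 - sum (count S) U + (card V - 2) * (q + 1) \<le> sum (count S) V"
      using n by (intro sum_pairwise_bound pair \<open>finite V\<close>) auto
    moreover have "(n - 2) * (q + 1) \<le> (card V - 2) * (q + 1)"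
      using n by (intro mult_le_mono1) simp
    ultimately show ?thesis using True size by linarith
  next
    case False
    then have "k + 1 \<le> 2 * q + sum (count S) U" by simp
    then have "2 * (k + 1) \<le> size S + 4 * q"
      using size le by (simp add: algebra_simps)
    then show ?thesis ..
  qed
qed

theorem theorem4p5:
  fixes G :: "('a, 'b) pre_digraph" and n m k :: nat
  assumes "m \<ge> n" and "n \<ge> 4" and "k \<ge> 1"
    and "complete_bipartite_digraph n m G"
  shows "int (robust_power_domination_number G k) \<ge>
    (if \<exists>i. 0 \<le> i \<and> i \<le> n - 4 \<and> [k = i] (mod (n + 2))
     then 2 * (int k + 1) - 4 * \<lfloor>real k / real (n + 2)\<rfloor>
     else int k + int n - 1 + (int n - 2) * \<lfloor>real k / real (n + 2)\<rfloor>)"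
proof -
  define q where "q = k div (n + 2)"
  define r where "r = k mod (n + 2)"
  obtain U V where "graph G" and verts: "verts G = U \<union> V" "U \<inter> V = {}"
    and card: "card U = n" "card V = m" and arcs: "arcs_ends G = U \<times> V \<union> V \<times> U"
    using assms(4) unfolding complete_bipartite_digraph_def by blast
  then interpret graph G by simp
  have fin: "finite U" "finite V" using verts finite_verts by (metis finite_Un)+
  have "verts G \<noteq> {}" using verts(1) card(1) assms(2) by auto
  then have ex: "\<exists>s S. robust_power_dominating G k S \<and> size S = s"
    using ex_robust_power_dominating[of G k] wf_digraph_axioms finite_verts by blast
  then obtain S where rob: "robust_power_dominating G k S"
    and S: "size S = robust_power_domination_number G k"
    unfolding robust_power_domination_number_def using LeastI_ex[OF ex] by blast
  have "2 * (k + 1) \<le> size S + 4 * q \<or> k + 1 + (n - 2) * (q + 1) \<le> size S"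
  proof (cases "sum (count S) U \<le> sum (count S) V")
    case True
    show ?thesis
      by (rule robust_size_lower_bound[OF rob verts fin arcs _ _ True]) (use assms card in auto)
  next
    case False
    show ?thesis
      by (rule robust_size_lower_bound[OF rob, where U = V and V = U])
        (use assms card verts fin arcs False in auto)
  qed
  then have "int (2 * (k + 1)) \<le> int (size S + 4 * q) \<or>
      int (k + 1 + (n - 2) * (q + 1)) \<le> int (size S)"
    by (simp only: of_nat_le_iff)
  then have bound: "2 * (int k + 1) - 4 * int q \<le> int (size S) \<or>
      int k + 1 + (int n - 2) * int q + (int n - 2) \<le> int (size S)"
    using \<open>n \<ge> 4\<close> by (auto simp: of_nat_diff distrib_left)
  have "k = q * (n + 2) + r" unfolding q_def r_def by (rule div_mult_mod_eq[symmetric])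
  \<comment> \<open>With \<open>n + 2\<close> split as \<open>(n - 2) + 4\<close>, the second bound
    minus the first is \<open>n - 3 - r\<close>, so the sign of this decides which is
    smaller.\<close>
  then have k: "int k = (int n - 2) * int q + 4 * int q + int r"
    by (simp add: algebra_simps)
  have residue: "(\<exists>i. 0 \<le> i \<and> i \<le> n - 4 \<and> [k = i] (mod (n + 2))) \<longleftrightarrow> r \<le> n - 4"
  proof
    assume "\<exists>i. 0 \<le> i \<and> i \<le> n - 4 \<and> [k = i] (mod (n + 2))"
    then show "r \<le> n - 4" by (auto simp: cong_def r_def)
  next
    assume "r \<le> n - 4"
    then show "\<exists>i. 0 \<le> i \<and> i \<le> n - 4 \<and> [k = i] (mod (n + 2))"
      by (intro exI[of _ r]) (simp add: cong_def r_def)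
  qed
  have floor: "\<lfloor>real k / real (n + 2)\<rfloor> = int q"
    unfolding q_def by (rule floor_divide_of_nat_eq)
  show ?thesis
    unfolding residue floor S[symmetric]
  proof (split if_split, intro conjI impI)
    assume "r \<le> n - 4"
    then have "int r \<le> int n - 4" using \<open>n \<ge> 4\<close> by linarith
    then show "2 * (int k + 1) - 4 * int q \<le> int (size S)"
      using bound k by (elim disjE) (simp_all add: algebra_simps)
  next
    assume "\<not> r \<le> n - 4"
    then have "int r \<ge> int n - 3" by linarith
    then show "int k + int n - 1 + (int n - 2) * int q \<le> int (size S)"
      using bound k by (elim disjE) (simp_all add: algebra_simps)
  qed
qed

end
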